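(* Let $\Omega\subset\mathbb{R}^d$ be open and bounded with piecewise Lipschitz continuous boundary, let $1<p<2$ and let $q$ be the conjugate exponent, $\frac1p+\frac1q=1$. Let $f\in L^q(\Omega,\mathbb{R})$, let $\gamma_\circ\in L^\infty(\Omega,\mathbb{R}_+)$, and let $\varepsilon\ge 0$ satisfy $\varepsilon<\operatorname{ess\,inf}_{\mathbf{x}\in\Omega}\gamma_\circ(\mathbf{x})$. Let $v\in H^1_0(\Omega)$ and $\mathbf{y}^*\in Q$, where $$Q:=\{\boldsymbol{\eta}^*\in L^q(\Omega,\mathbb{R}^d)\;|\;\operatorname{div}\boldsymbol{\eta}^*\in L^q(\Omega,\mathbb{R})\}.$$ Let $E^{\rm ind}(v,\mathbf{y}^* )$ be the error generated by the incompletely known data $\gamma=\gamma_\circ+\delta$, $\|\delta\|_{L^\infty(\Omega,\mathbb{R})}\le\varepsilon$, as defined in the context. Then $$\underline{E^{\rm ind}}(v,\mathbf{y}^* )\le E^{\rm ind}(v,\mathbf{y}^* )\le\overline{E^{\rm ind}}(v,\mathbf{y}^* ),$$ where $$\underline{E^{\rm ind}}(v,\mathbf{y}^* ):=\int_\Omega\max\{h(-\varepsilon,v,\mathbf{y}^*,\varepsilon),\,h(\varepsilon,v,\mathbf{y}^*,\varepsilon)\}\,d\mathbf{x},$$ $$\overline{E^{\rm ind}}(v,\mathbf{y}^* ):=\int_\Omega\max\{h(-\varepsilon,v,\mathbf{y}^*,-\varepsilon),\,h(\varepsilon,v,\mathbf{y}^*,-\varepsilon)\}\,d\mathbf{x},$$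 and, for real $\delta$ and $c$ (pointwise a.e. in $\Omega$), $$h(\delta,v,\mathbf{y}^*,c):=\delta\left(\tfrac1p|v|^p+(1-q)\gamma_\circ^{-q}\tfrac1q|-\operatorname{div}\mathbf{y}^*+f|^q\right)+\delta^2\left(\tfrac12(q-1)(\gamma_\circ+c)^{-q-1}|-\operatorname{div}\mathbf{y}^*+f|^q\right).$$
   Context: $\mathbb{R}_+$ denotes the positive reals. The underlying primal problem is to minimize over $H^1_0(\Omega)$ the functional $$J(v)=\int_\Omega\left(\tfrac12|\nabla v|^2+\tfrac1p\gamma|v|^p-fv\right)d\mathbf{x},$$ where the coefficient $\gamma$ is only known to belong to the admissible set $$\Upsilon:=\{\gamma\in L^\infty(\Omega,\mathbb{R})\;|\;\gamma=\gamma_\circ+\delta,\ \delta\in L^\infty(\Omega,\mathbb{R}),\ \|\delta\|_{L^\infty(\Omega,\mathbb{R})}\le\varepsilon\}.$$ The bound $\varepsilon<\operatorname{ess\,inf}\gamma_\circ$ guarantees that all elements of $\Upsilon$ are strictly positive. For $\gamma\in\Upsilon$ the duality gap (the error measure) is $$E_\gamma(v,\mathbf{y}^* ):=D_{F_\gamma}(v,-\operatorname{div}\mathbf{y}^* )+D_G(\nabla v,-\mathbf{y}^* ),$$ with the compound functionals $$D_{F_\gamma}(v,-\operatorname{div}\mathbf{y}^* )=\int_\Omega\left(\tfrac1p\gamma|v|^p+\tfrac1q\left(\tfrac1\gamma\right)^{q-1}|-\operatorname{div}\mathbf{y}^*+f|^q-(-\operatorname{div}\mathbf{y}^*+f)\,v\right)d\mathbf{x},$$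 $$D_G(\nabla v,-\mathbf{y}^* )=\tfrac12\|\nabla v+\mathbf{y}^*\|^2_{L^2(\Omega,\mathbb{R}^d)}.$$ Write $E_\circ:=E_{\gamma_\circ}$. The worst case error is $E^{\rm worst}(v,\mathbf{y}^* ):=\sup_{\gamma\in\Upsilon}E_\gamma(v,\mathbf{y}^* )$. The error generated by the incompletely known data is $$E^{\rm ind}(v,\mathbf{y}^* ):=\sup_{\|\delta\|_{L^\infty(\Omega,\mathbb{R})}\le\varepsilon}\left(E_{\gamma_\circ+\delta}(v,\mathbf{y}^* )-E_\circ(v,\mathbf{y}^* )\right),$$ so that $E^{\rm worst}(v,\mathbf{y}^* )=E_\circ(v,\mathbf{y}^* )+E^{\rm ind}(v,\mathbf{y}^* )$. *)

theory Defs
  imports "HOL-Analysis.Analysis" "HOL-Probability.Essential_Supremum"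
begin

text \<open>
  Functions on \<open>\<Omega>\<close> are total functions on \<open>real ^ 'd\<close>; only their restriction to \<open>\<Omega>\<close>, up to
  null sets, matters, since everything is measured by \<open>lebesgue_on \<Omega>\<close>.
\<close>

definition Lp :: "real \<Rightarrow> (real ^ 'd::finite) set \<Rightarrow> (real ^ 'd \<Rightarrow> 'b::euclidean_space) set" where
  "Lp r \<Omega> = {g. g \<in> borel_measurable (lebesgue_on \<Omega>) \<and>
                integrable (lebesgue_on \<Omega>) (\<lambda>x. norm (g x) powr r)}"

definition Linf_norm :: "(real ^ 'd::finite) set \<Rightarrow> (real ^ 'd \<Rightarrow> real) \<Rightarrow> ereal" where
  "Linf_norm \<Omega> g = esssup (lebesgue_on \<Omega>) (\<lambda>x. ereal \<bar>g x\<bar>)"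

definition Linf :: "(real ^ 'd::finite) set \<Rightarrow> (real ^ 'd \<Rightarrow> real) set" where
  "Linf \<Omega> = {g. g \<in> borel_measurable (lebesgue_on \<Omega>) \<and> Linf_norm \<Omega> g < \<infinity>}"

definition Linf_pos :: "(real ^ 'd::finite) set \<Rightarrow> (real ^ 'd \<Rightarrow> real) set" where
  "Linf_pos \<Omega> = {g \<in> Linf \<Omega>. AE x in lebesgue_on \<Omega>. g x > 0}"

definition ess_inf :: "(real ^ 'd::finite) set \<Rightarrow> (real ^ 'd \<Rightarrow> real) \<Rightarrow> ereal" where
  "ess_inf \<Omega> g = - esssup (lebesgue_on \<Omega>) (\<lambda>x. - ereal (g x))"

definition partial_deriv :: "'d \<Rightarrow> (real ^ 'd::finite \<Rightarrow> real) \<Rightarrow> real ^ 'd \<Rightarrow> real" where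
  "partial_deriv i \<phi> x = frechet_derivative \<phi> (at x) (axis i 1)"

definition grad :: "(real ^ 'd::finite \<Rightarrow> real) \<Rightarrow> real ^ 'd \<Rightarrow> real ^ 'd" where
  "grad \<phi> x = (\<chi> i. partial_deriv i \<phi> x)"

primrec Ck :: "nat \<Rightarrow> (real ^ 'd::finite \<Rightarrow> real) \<Rightarrow> bool" where
  "Ck 0 \<phi> \<longleftrightarrow> continuous_on UNIV \<phi>"
| "Ck (Suc k) \<phi> \<longleftrightarrow> (\<forall>x. \<phi> differentiable (at x)) \<and> (\<forall>i. Ck k (partial_deriv i \<phi>))"

definition test_functions :: "(real ^ 'd::finite) set \<Rightarrow> (real ^ 'd \<Rightarrow> real) set" where
  "test_functions \<Omega> = {\<phi>. (\<forall>k. Ck k \<phi>) \<and>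
     compact (closure {x. \<phi> x \<noteq> 0}) \<and> closure {x. \<phi> x \<noteq> 0} \<subseteq> \<Omega>}"

text \<open>
  Both predicates are only used for functions in some \<open>Lp r \<Omega>\<close> with \<open>r \<ge> 1\<close>, so that all
  integrals below exist.
\<close>

definition has_weak_grad ::
  "(real ^ 'd::finite) set \<Rightarrow> (real ^ 'd \<Rightarrow> real) \<Rightarrow> (real ^ 'd \<Rightarrow> real ^ 'd) \<Rightarrow> bool" where
  "has_weak_grad \<Omega> u g \<longleftrightarrow> (\<forall>\<phi>\<in>test_functions \<Omega>. \<forall>i.
     (\<integral>x. u x * partial_deriv i \<phi> x \<partial>lebesgue_on \<Omega>) = - (\<integral>x. g x $ i * \<phi> x \<partial>lebesgue_on \<Omega>))"

definition has_weak_div ::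
  "(real ^ 'd::finite) set \<Rightarrow> (real ^ 'd \<Rightarrow> real ^ 'd) \<Rightarrow> (real ^ 'd \<Rightarrow> real) \<Rightarrow> bool" where
  "has_weak_div \<Omega> y d \<longleftrightarrow> (\<forall>\<phi>\<in>test_functions \<Omega>.
     (\<integral>x. y x \<bullet> grad \<phi> x \<partial>lebesgue_on \<Omega>) = - (\<integral>x. d x * \<phi> x \<partial>lebesgue_on \<Omega>))"

text \<open>
  Weak gradients and divergences are unique up to null sets. The following operators pick a
  representative in the relevant Lebesgue space; they are meaningful on \<open>H1\<close>, respectively on
  \<open>Q_space q\<close>, where such a representative exists.
\<close>

definition weak_grad ::
  "(real ^ 'd::finite) set \<Rightarrow> (real ^ 'd \<Rightarrow> real) \<Rightarrow> real ^ 'd \<Rightarrow> real ^ 'd" where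
  "weak_grad \<Omega> u = (SOME g. g \<in> Lp 2 \<Omega> \<and> has_weak_grad \<Omega> u g)"

definition weak_div ::
  "real \<Rightarrow> (real ^ 'd::finite) set \<Rightarrow> (real ^ 'd \<Rightarrow> real ^ 'd) \<Rightarrow> real ^ 'd \<Rightarrow> real" where
  "weak_div q \<Omega> y = (SOME d. d \<in> Lp q \<Omega> \<and> has_weak_div \<Omega> y d)"

definition Q_space :: "real \<Rightarrow> (real ^ 'd::finite) set \<Rightarrow> (real ^ 'd \<Rightarrow> real ^ 'd) set" where
  "Q_space q \<Omega> = {y. y \<in> Lp q \<Omega> \<and> (\<exists>d. d \<in> Lp q \<Omega> \<and> has_weak_div \<Omega> y d)}"

definition H1 :: "(real ^ 'd::finite) set \<Rightarrow> (real ^ 'd \<Rightarrow> real) set" where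
  "H1 \<Omega> = {u. u \<in> Lp 2 \<Omega> \<and> (\<exists>g. g \<in> Lp 2 \<Omega> \<and> has_weak_grad \<Omega> u g)}"

definition H1_norm :: "(real ^ 'd::finite) set \<Rightarrow> (real ^ 'd \<Rightarrow> real) \<Rightarrow> real" where
  "H1_norm \<Omega> u = sqrt ((\<integral>x. (u x)\<^sup>2 \<partial>lebesgue_on \<Omega>) +
                       (\<integral>x. (norm (weak_grad \<Omega> u x))\<^sup>2 \<partial>lebesgue_on \<Omega>))"

definition H10 :: "(real ^ 'd::finite) set \<Rightarrow> (real ^ 'd \<Rightarrow> real) set" where
  "H10 \<Omega> = {u \<in> H1 \<Omega>. \<forall>e>0. \<exists>\<phi>\<in>test_functions \<Omega>. H1_norm \<Omega> (\<lambda>x. u x - \<phi> x) < e}"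

text \<open>
  A Lipschitz piece is the graph, in some orthonormal coordinate system with vertical direction
  \<open>\<nu>\<close>, of a Lipschitz function over the closure of a bounded relatively open subset of the
  hyperplane orthogonal to \<open>\<nu>\<close>. The boundary is piecewise Lipschitz if it is a finite union of
  such pieces; the boundary of a bounded Lipschitz domain has this property by compactness.
\<close>

definition lipschitz_piece :: "(real ^ 'd::finite) set \<Rightarrow> bool" where
  "lipschitz_piece K \<longleftrightarrow> (\<exists>\<nu> U g L. norm \<nu> = 1 \<and> bounded U \<and>
     openin (top_of_set {z. \<nu> \<bullet> z = 0}) U \<and> L-lipschitz_on (closure U) g \<and>
     K = (\<lambda>z. z + g z *\<^sub>R \<nu>) ` closure U)"

definition piecewise_lipschitz_boundary :: "(real ^ 'd::finite) set \<Rightarrow> bool" where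
  "piecewise_lipschitz_boundary \<Omega> \<longleftrightarrow>
     (\<exists>\<K>. finite \<K> \<and> (\<forall>K\<in>\<K>. lipschitz_piece K) \<and> frontier \<Omega> = \<Union>\<K>)"

definition D_F :: "(real ^ 'd::finite) set \<Rightarrow> real \<Rightarrow> real \<Rightarrow> (real ^ 'd \<Rightarrow> real) \<Rightarrow>
    (real ^ 'd \<Rightarrow> real) \<Rightarrow> (real ^ 'd \<Rightarrow> real) \<Rightarrow> (real ^ 'd \<Rightarrow> real) \<Rightarrow> real" where
  "D_F \<Omega> p q f \<gamma> v \<eta> =
     (\<integral>x. (1 / p) * \<gamma> x * \<bar>v x\<bar> powr p
          + (1 / q) * (1 / \<gamma> x) powr (q - 1) * \<bar>\<eta> x + f x\<bar> powr q
          - (\<eta> x + f x) * v x \<partial>lebesgue_on \<Omega>)"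

definition D_G :: "(real ^ 'd::finite) set \<Rightarrow> (real ^ 'd \<Rightarrow> real ^ 'd) \<Rightarrow>
    (real ^ 'd \<Rightarrow> real ^ 'd) \<Rightarrow> real" where
  "D_G \<Omega> g \<eta> = (1 / 2) * (\<integral>x. (norm (g x - \<eta> x))\<^sup>2 \<partial>lebesgue_on \<Omega>)"

definition E_err :: "(real ^ 'd::finite) set \<Rightarrow> real \<Rightarrow> real \<Rightarrow> (real ^ 'd \<Rightarrow> real) \<Rightarrow>
    (real ^ 'd \<Rightarrow> real) \<Rightarrow> (real ^ 'd \<Rightarrow> real) \<Rightarrow> (real ^ 'd \<Rightarrow> real ^ 'd) \<Rightarrow> real" where
  "E_err \<Omega> p q f \<gamma> v y =
     D_F \<Omega> p q f \<gamma> v (\<lambda>x. - weak_div q \<Omega> y x) + D_G \<Omega> (weak_grad \<Omega> v) (\<lambda>x. - y x)"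

text \<open>The supremum is taken in \<open>ereal\<close>, where it exists without a boundedness proviso.\<close>

definition E_ind :: "(real ^ 'd::finite) set \<Rightarrow> real \<Rightarrow> real \<Rightarrow> (real ^ 'd \<Rightarrow> real) \<Rightarrow>
    (real ^ 'd \<Rightarrow> real) \<Rightarrow> real \<Rightarrow> (real ^ 'd \<Rightarrow> real) \<Rightarrow> (real ^ 'd \<Rightarrow> real ^ 'd) \<Rightarrow> ereal" where
  "E_ind \<Omega> p q f \<gamma>\<^sub>0 \<epsilon> v y =
     (SUP \<delta>\<in>{\<delta> \<in> Linf \<Omega>. Linf_norm \<Omega> \<delta> \<le> ereal \<epsilon>}.
        ereal (E_err \<Omega> p q f (\<lambda>x. \<gamma>\<^sub>0 x + \<delta> x) v y - E_err \<Omega> p q f \<gamma>\<^sub>0 v y))"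

definition h_fun :: "(real ^ 'd::finite) set \<Rightarrow> real \<Rightarrow> real \<Rightarrow> (real ^ 'd \<Rightarrow> real) \<Rightarrow>
    (real ^ 'd \<Rightarrow> real) \<Rightarrow> real \<Rightarrow> (real ^ 'd \<Rightarrow> real) \<Rightarrow> (real ^ 'd \<Rightarrow> real ^ 'd) \<Rightarrow> real \<Rightarrow>
    real ^ 'd \<Rightarrow> real" where
  "h_fun \<Omega> p q f \<gamma>\<^sub>0 \<delta> v y c x =
     \<delta> * ((1 / p) * \<bar>v x\<bar> powr p
          + (1 - q) * \<gamma>\<^sub>0 x powr (- q) * (1 / q) * \<bar>- weak_div q \<Omega> y x + f x\<bar> powr q)
     + \<delta>\<^sup>2 * ((1 / 2) * (q - 1) * (\<gamma>\<^sub>0 x + c) powr (- q - 1)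
          * \<bar>- weak_div q \<Omega> y x + f x\<bar> powr q)"

definition E_ind_lower :: "(real ^ 'd::finite) set \<Rightarrow> real \<Rightarrow> real \<Rightarrow> (real ^ 'd \<Rightarrow> real) \<Rightarrow>
    (real ^ 'd \<Rightarrow> real) \<Rightarrow> real \<Rightarrow> (real ^ 'd \<Rightarrow> real) \<Rightarrow> (real ^ 'd \<Rightarrow> real ^ 'd) \<Rightarrow> real" where
  "E_ind_lower \<Omega> p q f \<gamma>\<^sub>0 \<epsilon> v y =
     (\<integral>x. max (h_fun \<Omega> p q f \<gamma>\<^sub>0 (- \<epsilon>) v y \<epsilon> x) (h_fun \<Omega> p q f \<gamma>\<^sub>0 \<epsilon> v y \<epsilon> x) \<partial>lebesgue_on \<Omega>)"

definition E_ind_upper :: "(real ^ 'd::finite) set \<Rightarrow> real \<Rightarrow> real \<Rightarrow> (real ^ 'd \<Rightarrow> real) \<Rightarrow>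
    (real ^ 'd \<Rightarrow> real) \<Rightarrow> real \<Rightarrow> (real ^ 'd \<Rightarrow> real) \<Rightarrow> (real ^ 'd \<Rightarrow> real ^ 'd) \<Rightarrow> real" where
  "E_ind_upper \<Omega> p q f \<gamma>\<^sub>0 \<epsilon> v y =
     (\<integral>x. max (h_fun \<Omega> p q f \<gamma>\<^sub>0 (- \<epsilon>) v y (- \<epsilon>) x) (h_fun \<Omega> p q f \<gamma>\<^sub>0 \<epsilon> v y (- \<epsilon>) x)
        \<partial>lebesgue_on \<Omega>)"

end

theory Submission
  imports Defs
begin

text \<open>
  By Taylor's formula, replacing \<open>a > 0\<close> by \<open>a + \<delta>\<close> changes \<open>a powr (1 - q) / q\<close> by
  \<open>\<delta> * (1 - q) / q * a powr (- q) + \<delta>\<^sup>2 / 2 * (q - 1) * t powr (- q - 1)\<close> for some \<open>t\<close> between \<open>a\<close>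
  and \<open>a + \<delta>\<close>. The remainder decreases in \<open>t\<close>, so \<open>t = a \<plusminus> \<epsilon>\<close> bounds it for all \<open>\<bar>\<delta>\<bar> \<le> \<epsilon>\<close>; both
  resulting bounds are the functions \<open>h\<close>, which are convex quadratics in \<open>\<delta>\<close> and hence largest at
  \<open>\<delta> = \<plusminus>\<epsilon>\<close>. The upper bound follows by integration, the lower one by letting \<open>\<delta>\<close> take, at each
  point, the better of the two values \<open>\<plusminus>\<epsilon>\<close>.
\<close>

section \<open>Second-order pointwise bounds for a perturbed power\<close>

lemma powr_taylor2:
  fixes a \<delta> e q :: real
  assumes "1 < q" "\<bar>\<delta>\<bar> \<le> e" "e < a"
  obtains t where "a - e \<le> t" "t \<le> a + e"
    "(a + \<delta>) powr (1 - q) / q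
      = a powr (1 - q) / q + \<delta> * ((1 - q) / q * a powr (- q)) + \<delta>\<^sup>2 * ((1 / 2) * (q - 1) * t powr (- q - 1))"
proof (cases "\<delta> = 0")
  \<comment> \<open>\<open>Taylor\<close> needs an evaluation point different from the centre. Here
    the quadratic term vanishes, so any \<open>t\<close> in the interval serves.\<close>
  case True
  then show ?thesis using assms by (intro that[of a]) auto
next
  case False
  \<comment> \<open>\<open>D m\<close> is the m-th derivative of \<open>t powr (1 - q) / q\<close>
    for m \<le> 2, all that an order-two expansion asks for. The division by \<open>q\<close>
    cancels the factor \<open>- q\<close> of the second differentiation.\<close>
  define D where "D m t = (if m = 0 then t powr (1 - q) / q
     else if m = 1 then (1 - q) / q * t powr (- q) else (q - 1) * t powr (- q - 1))"
    for m :: nat and t :: real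
  have "DERIV (D m) t :> D (Suc m) t" if "m < 2" "a - e \<le> t" for m t
  proof -
    have t: "t > 0" using that assms by linarith
    have "DERIV (\<lambda>t. t powr (1 - q) / q) t :> (1 - q) / q * t powr (- q)"
      using DERIV_cdivide[OF has_real_derivative_powr[OF t, of "1 - q"], of q] by simp
    moreover have "DERIV (\<lambda>t. (1 - q) / q * t powr (- q)) t :> (q - 1) * t powr (- q - 1)"
    proof -
      have eq: "(1 - q) / q * (- q * t powr (- q - 1)) = (q - 1) * t powr (- q - 1)"
        using assms(1) by (simp add: field_simps)
      show ?thesis
        using DERIV_cmult[OF has_real_derivative_powr[OF t, of "- q"], of "(1 - q) / q"]
        unfolding eq .
    qed
    moreover have "D 0 = (\<lambda>t. t powr (1 - q) / q)" "D 1 = (\<lambda>t. (1 - q) / q * t powr (- q))"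
      "D 2 = (\<lambda>t. (q - 1) * t powr (- q - 1))"
      by (auto simp: D_def fun_eq_iff)
    moreover have "m = 0 \<or> m = 1" using that by auto
    ultimately show ?thesis by (auto simp: numeral_2_eq_2)
  qed
  then have "\<exists>t. (if a + \<delta> < a then a + \<delta> < t \<and> t < a else a < t \<and> t < a + \<delta>)
      \<and> D 0 (a + \<delta>) = (\<Sum>m<2. D m a / fact m * (a + \<delta> - a) ^ m)
          + D 2 t / fact 2 * (a + \<delta> - a) ^ 2"
    by (intro Taylor[where a = "a - e" and b = "a + e"]) (use assms False in auto)
  then obtain t where t: "if a + \<delta> < a then a + \<delta> < t \<and> t < a else a < t \<and> t < a + \<delta>"
    and eq: "D 0 (a + \<delta>) = (\<Sum>m<2. D m a / fact m * (a + \<delta> - a) ^ m)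
          + D 2 t / fact 2 * (a + \<delta> - a) ^ 2"
    by blast
  show ?thesis
  proof (rule that)
    show "a - e \<le> t" "t \<le> a + e" using t assms by (auto split: if_splits)
  qed (use eq in \<open>simp add: D_def numeral_2_eq_2 field_simps\<close>)
qed

text \<open>\<open>r\<close> is the pointwise change of the \<open>D_F\<close> integrand when the
  coefficient moves from \<open>a\<close> to \<open>a + \<delta>\<close>, with \<open>P\<close> for
  the term in \<open>v\<close> and \<open>w\<close> for the power of the dual residual.
  \<open>H c\<close> is \<open>h_fun\<close> at that point.\<close>

lemma powr_perturbation_bounds:
  fixes a \<delta> e q P w :: real
  assumes "1 < q" "\<bar>\<delta>\<bar> \<le> e" "e < a" "0 \<le> w"
  defines "H c \<equiv> \<delta> * (P + (1 - q) * a powr (- q) * (1 / q) * w)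
                 + \<delta>\<^sup>2 * ((1 / 2) * (q - 1) * (a + c) powr (- q - 1) * w)"
    and "r \<equiv> \<delta> * P + (1 / q) * (1 / (a + \<delta>)) powr (q - 1) * w - (1 / q) * (1 / a) powr (q - 1) * w"
  shows "H e \<le> r" and "r \<le> H (- e)"
proof -
  obtain t where t: "a - e \<le> t" "t \<le> a + e"
    and eq: "(a + \<delta>) powr (1 - q) / q = a powr (1 - q) / q + \<delta> * ((1 - q) / q * a powr (- q))
       + \<delta>\<^sup>2 * ((1 / 2) * (q - 1) * t powr (- q - 1))"
    using powr_taylor2[OF assms(1-3)] .
  have inv: "(1 / s) powr (q - 1) = s powr (1 - q)" if "s > 0" for s :: real
    using that powr_minus_divide[of s "q - 1"] by (simp add: powr_divide)
  have "r = \<delta> * P + ((a + \<delta>) powr (1 - q) / q - a powr (1 - q) / q) * w"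
    using assms by (simp add: r_def inv field_simps)
  also have "\<dots> = \<delta> * (P + (1 - q) * a powr (- q) * (1 / q) * w)
       + \<delta>\<^sup>2 * ((1 / 2) * (q - 1) * t powr (- q - 1) * w)"
    unfolding eq using assms(1) by (simp add: field_simps)
  finally have r: "r = \<dots>" .
  have "(a + e) powr (- q - 1) \<le> t powr (- q - 1)" "t powr (- q - 1) \<le> (a + - e) powr (- q - 1)"
    using t assms by (auto intro!: powr_mono2')
  \<comment> \<open>The linear terms coincide, and the remainder carries the nonnegative factors
    \<open>\<delta>\<^sup>2\<close>, \<open>q - 1\<close> and \<open>w\<close>, so the sign of
    \<open>\<delta>\<close> is irrelevant.\<close>
  then show "H e \<le> r" "r \<le> H (- e)"
    unfolding r H_def using assms by (auto intro!: mult_left_mono mult_right_mono)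
qed

text \<open>The linear term is at most \<open>e * \<bar>K\<bar>\<close> and the quadratic one at
  most \<open>e\<^sup>2 * W\<close>; both bounds are attained together at the endpoint whose sign
  agrees with that of \<open>K\<close>.\<close>

lemma quadratic_le_max_endpoints:
  fixes \<delta> e K W :: real
  assumes "\<bar>\<delta>\<bar> \<le> e" "0 \<le> W"
  shows "\<delta> * K + \<delta>\<^sup>2 * W \<le> max (- e * K + (- e)\<^sup>2 * W) (e * K + e\<^sup>2 * W)"
proof -
  have "\<delta>\<^sup>2 * W \<le> e\<^sup>2 * W"
    using assms by (intro mult_right_mono) (auto simp: abs_le_square_iff[symmetric])
  moreover have "\<delta> * K \<le> \<bar>\<delta>\<bar> * \<bar>K\<bar>" by (metis abs_ge_self abs_mult)
  moreover have "\<bar>\<delta>\<bar> * \<bar>K\<bar> \<le> e * \<bar>K\<bar>" using assms by (intro mult_right_mono) auto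
  moreover have "e * \<bar>K\<bar> = e * K \<or> e * \<bar>K\<bar> = - e * K" by (simp add: abs_if)
  ultimately show ?thesis by (auto simp: max_def)
qed

section \<open>Essential bounds and domination\<close>

lemma integrable_mult_AE_bounded:
  fixes g u :: "'a \<Rightarrow> real"
  assumes "integrable M u" "g \<in> borel_measurable M" "AE x in M. \<bar>g x\<bar> \<le> B"
  shows "integrable M (\<lambda>x. g x * u x)"
proof (rule Bochner_Integration.integrable_bound)
  show "integrable M (\<lambda>x. B * u x)" using assms by simp
  show "AE x in M. norm (g x * u x) \<le> norm (B * u x)"
    using assms(3) by eventually_elim (auto simp: abs_mult intro!: mult_right_mono)
  show "(\<lambda>x. g x * u x) \<in> borel_measurable M" using assms by measurable
qed

lemma Linf_norm_leD:
  assumes "\<delta> \<in> Linf \<Omega>" "Linf_norm \<Omega> \<delta> \<le> ereal e"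
  shows "AE x in lebesgue_on \<Omega>. \<bar>\<delta> x\<bar> \<le> e"
proof -
  have "AE x in lebesgue_on \<Omega>. ereal \<bar>\<delta> x\<bar> \<le> Linf_norm \<Omega> \<delta>"
    unfolding Linf_norm_def by (rule esssup_AE)
  then show ?thesis by eventually_elim (use assms(2) in \<open>auto dest: order_trans\<close>)
qed

lemma Linf_normI:
  assumes "\<delta> \<in> borel_measurable (lebesgue_on \<Omega>)" "AE x in lebesgue_on \<Omega>. \<bar>\<delta> x\<bar> \<le> e"
  shows "\<delta> \<in> Linf \<Omega>" "Linf_norm \<Omega> \<delta> \<le> ereal e"
proof -
  show *: "Linf_norm \<Omega> \<delta> \<le> ereal e"
    unfolding Linf_norm_def by (rule esssup_I) (use assms in auto)
  then show "\<delta> \<in> Linf \<Omega>" using assms by (auto simp: Linf_def intro: le_less_trans)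
qed

lemma Linf_AE_bounded:
  assumes "g \<in> Linf \<Omega>"
  obtains B where "AE x in lebesgue_on \<Omega>. \<bar>g x\<bar> \<le> B"
proof -
  \<comment> \<open>The norm may be \<open>- \<infinity>\<close>, namely when
    \<open>\<Omega>\<close> is a null set; a real upper bound exists then too.\<close>
  obtain B where "Linf_norm \<Omega> g \<le> ereal B"
    using assms by (cases "Linf_norm \<Omega> g") (auto simp: Linf_def)
  then show thesis using Linf_norm_leD[OF assms] that by blast
qed

text \<open>The strict gap leaves room for a real \<open>m\<close>, even if the essential infimum is
  infinite. It keeps every admissible coefficient above \<open>m - e > 0\<close>, uniformly in the
  perturbation.\<close>

lemma less_ess_infD:
  assumes "ereal e < ess_inf \<Omega> g"
  obtains m where "e < m" "AE x in lebesgue_on \<Omega>. m \<le> g x"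
proof -
  obtain m where m: "ereal e < ereal m" "ereal m < ess_inf \<Omega> g"
    using ereal_dense2[OF assms] by auto
  have "AE x in lebesgue_on \<Omega>. - ereal (g x) \<le> esssup (lebesgue_on \<Omega>) (\<lambda>x. - ereal (g x))"
    by (rule esssup_AE)
  then have "AE x in lebesgue_on \<Omega>. m \<le> g x"
  proof eventually_elim
    case (elim x)
    then have "ess_inf \<Omega> g \<le> ereal (g x)"
      unfolding ess_inf_def using ereal_uminus_le_reorder by blast
    with m show ?case by (metis ereal_less_eq(3) less_le_trans less_imp_le)
  qed
  with m that show thesis by auto
qed

section \<open>Conjugate exponents and Lebesgue spaces\<close>

lemma conjugate_exponent_gt_1:
  fixes p q :: real
  assumes "1 < p" "1 / p + 1 / q = 1"
  shows "1 < q"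
proof -
  \<comment> \<open>Positivity of \<open>1 / q\<close> excludes negative \<open>q\<close> and also
    \<open>q = 0\<close>, where \<open>1 / q\<close> is 0 by convention.\<close>
  have "0 < 1 / p" "1 / p < 1" using assms by auto
  then have "0 < 1 / q" "1 / q < 1" using assms by linarith+
  then show ?thesis by (auto simp: divide_less_eq_1)
qed

lemma Lp_measurable: "g \<in> Lp r \<Omega> \<Longrightarrow> g \<in> borel_measurable (lebesgue_on \<Omega>)"
  by (simp add: Lp_def)

text \<open>Domination by \<open>1 + norm (g x) powr s\<close>, whose constant is integrable on a
  set of finite measure. This takes \<open>v\<close> from exponent 2 to exponent
  \<open>p\<close>.\<close>

lemma Lp_mono_exponent:
  assumes "g \<in> Lp s \<Omega>" "0 \<le> r" "r \<le> s" "\<Omega> \<in> lmeasurable"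
  shows "g \<in> Lp r \<Omega>"
proof -
  have [measurable]: "g \<in> borel_measurable (lebesgue_on \<Omega>)" using assms by (simp add: Lp_def)
  have "integrable (lebesgue_on \<Omega>) (\<lambda>x. norm (g x) powr r)"
  proof (rule Bochner_Integration.integrable_bound)
    show "integrable (lebesgue_on \<Omega>) (\<lambda>x. 1 + norm (g x) powr s)"
      using assms finite_measure.integrable_const[OF finite_measure_lebesgue_on]
      by (intro Bochner_Integration.integrable_add) (auto simp: Lp_def)
    have "t powr r \<le> 1 + t powr s" if "0 \<le> t" for t :: real
    proof (cases "t \<le> 1")
      case True
      then have "t powr r \<le> 1" using that assms powr_mono2[of r t 1] by auto
      then show ?thesis using powr_ge_zero[of t s] by linarith
    next
      case False
      then show ?thesis using assms(3) powr_mono[of r s t] by linarith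
    qed
    then show "AE x in lebesgue_on \<Omega>. norm (norm (g x) powr r) \<le> norm (1 + norm (g x) powr s)"
      by auto
  qed measurable
  then show ?thesis by (simp add: Lp_def)
qed

text \<open>The crude bound by twice the larger norm replaces Minkowski's inequality and works for
  every \<open>r \<ge> 0\<close>.\<close>

lemma Lp_add:
  fixes g k :: "real ^ 'd::finite \<Rightarrow> 'b::euclidean_space"
  assumes "g \<in> Lp r \<Omega>" "k \<in> Lp r \<Omega>" "0 \<le> r"
  shows "(\<lambda>x. g x + k x) \<in> Lp r \<Omega>"
proof -
  have [measurable]: "g \<in> borel_measurable (lebesgue_on \<Omega>)" "k \<in> borel_measurable (lebesgue_on \<Omega>)"
    using assms by (simp_all add: Lp_def)
  have "integrable (lebesgue_on \<Omega>) (\<lambda>x. norm (g x + k x) powr r)"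
  proof (rule Bochner_Integration.integrable_bound)
    show "integrable (lebesgue_on \<Omega>) (\<lambda>x. 2 powr r * (norm (g x) powr r + norm (k x) powr r))"
      using assms by (auto simp: Lp_def)
    have "norm (a + b) powr r \<le> 2 powr r * (norm a powr r + norm b powr r)" for a b :: 'b
    proof -
      have "norm (a + b) powr r \<le> (2 * max (norm a) (norm b)) powr r"
        using norm_triangle_ineq[of a b] assms by (intro powr_mono2) auto
      also have "\<dots> = 2 powr r * max (norm a) (norm b) powr r" by (simp add: powr_mult)
      also have "\<dots> \<le> 2 powr r * (norm a powr r + norm b powr r)"
        by (intro mult_left_mono) (auto simp: max_def)
      finally show ?thesis .
    qed
    then show "AE x in lebesgue_on \<Omega>. norm (norm (g x + k x) powr r)
        \<le> norm (2 powr r * (norm (g x) powr r + norm (k x) powr r))"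
      by auto
  qed measurable
  then show ?thesis by (simp add: Lp_def)
qed

lemma Lp_uminus: "g \<in> Lp r \<Omega> \<Longrightarrow> (\<lambda>x. - g x) \<in> Lp r \<Omega>"
  by (auto simp: Lp_def)

text \<open>Young's inequality gives an integrable majorant; no norm estimate as in Hoelder's
  inequality is sought.\<close>

lemma Lp_mult_integrable:
  fixes g k :: "real ^ 'd::finite \<Rightarrow> real"
  assumes "g \<in> Lp q \<Omega>" "k \<in> Lp p \<Omega>" "1 < p" "1 / p + 1 / q = 1"
  shows "integrable (lebesgue_on \<Omega>) (\<lambda>x. g x * k x)"
proof (rule Bochner_Integration.integrable_bound)
  have [measurable]: "g \<in> borel_measurable (lebesgue_on \<Omega>)" "k \<in> borel_measurable (lebesgue_on \<Omega>)"
    using assms by (simp_all add: Lp_def)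
  show "(\<lambda>x. g x * k x) \<in> borel_measurable (lebesgue_on \<Omega>)" by measurable
  show "integrable (lebesgue_on \<Omega>) (\<lambda>x. \<bar>k x\<bar> powr p / p + \<bar>g x\<bar> powr q / q)"
    using assms by (auto simp: Lp_def)
  have q: "1 < q" using conjugate_exponent_gt_1 assms by blast
  show "AE x in lebesgue_on \<Omega>. norm (g x * k x) \<le> norm (\<bar>k x\<bar> powr p / p + \<bar>g x\<bar> powr q / q)"
    using Youngs_inequality[of p q "\<bar>k x\<bar>" "\<bar>g x\<bar>" for x] assms q
    by (auto simp: abs_mult mult.commute)
qed

lemma weak_div_Lp:
  assumes "y \<in> Q_space q \<Omega>"
  shows "weak_div q \<Omega> y \<in> Lp q \<Omega>"
  using someI_ex[of "\<lambda>d. d \<in> Lp q \<Omega> \<and> has_weak_div \<Omega> y d"] assms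
  unfolding weak_div_def Q_space_def by blast

section \<open>From the pointwise bounds to the integrals\<close>

theorem theorem3p1:
  fixes \<Omega> :: "(real ^ 'd::finite) set"
    and p q \<epsilon> :: real
    and f \<gamma>\<^sub>0 v :: "real ^ 'd \<Rightarrow> real"
    and y :: "real ^ 'd \<Rightarrow> real ^ 'd"
  assumes "open \<Omega>" and "bounded \<Omega>" and "piecewise_lipschitz_boundary \<Omega>"
    and "1 < p" and "p < 2" and "1 / p + 1 / q = 1"
    and "f \<in> Lp q \<Omega>"
    and "\<gamma>\<^sub>0 \<in> Linf_pos \<Omega>"
    and "0 \<le> \<epsilon>" and "ereal \<epsilon> < ess_inf \<Omega> \<gamma>\<^sub>0"
    and "v \<in> H10 \<Omega>"
    and "y \<in> Q_space q \<Omega>"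
  shows "ereal (E_ind_lower \<Omega> p q f \<gamma>\<^sub>0 \<epsilon> v y) \<le> E_ind \<Omega> p q f \<gamma>\<^sub>0 \<epsilon> v y
       \<and> E_ind \<Omega> p q f \<gamma>\<^sub>0 \<epsilon> v y \<le> ereal (E_ind_upper \<Omega> p q f \<gamma>\<^sub>0 \<epsilon> v y)"
proof -
  let ?M = "lebesgue_on \<Omega>"
  \<comment> \<open>\<open>U \<gamma>\<close> is the integrand of \<open>D_F\<close>;
    \<open>A\<close> and \<open>w\<close> isolate its factors free of \<open>\<gamma>\<close> and
    play the roles of \<open>P\<close> and \<open>w\<close> in
    \<open>powr_perturbation_bounds\<close>.\<close>
  define w where "w x = \<bar>- weak_div q \<Omega> y x + f x\<bar> powr q" for x
  define A where "A x = (1 / p) * \<bar>v x\<bar> powr p" for x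
  define U where "U \<gamma> x = (1 / p) * \<gamma> x * \<bar>v x\<bar> powr p
          + (1 / q) * (1 / \<gamma> x) powr (q - 1) * \<bar>- weak_div q \<Omega> y x + f x\<bar> powr q
          - (- weak_div q \<Omega> y x + f x) * v x" for \<gamma> x
  define h where "h = (\<lambda>\<delta> c. h_fun \<Omega> p q f \<gamma>\<^sub>0 \<delta> v y c)"
  have h: "h \<delta> c x = \<delta> * (A x + (1 - q) * \<gamma>\<^sub>0 x powr (- q) * (1 / q) * w x)
       + \<delta>\<^sup>2 * ((1 / 2) * (q - 1) * (\<gamma>\<^sub>0 x + c) powr (- q - 1) * w x)" for \<delta> c x
    by (simp add: h_def h_fun_def A_def w_def)
  have q: "1 < q" using conjugate_exponent_gt_1 assms by blast
  have \<Omega>: "\<Omega> \<in> lmeasurable" using assms by (simp add: lmeasurable_open)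
  have "v \<in> Lp 2 \<Omega>" using assms by (simp add: H10_def H1_def)
  then have v: "v \<in> Lp p \<Omega>" using Lp_mono_exponent[of v 2 \<Omega> p] assms \<Omega> by simp
  have g: "(\<lambda>x. - weak_div q \<Omega> y x + f x) \<in> Lp q \<Omega>"
    using assms q by (intro Lp_add Lp_uminus weak_div_Lp) auto
  have iw: "integrable ?M w" using g by (simp add: Lp_def w_def [abs_def])
  have iA: "integrable ?M A" using v by (simp add: Lp_def A_def [abs_def])
  have igv: "integrable ?M (\<lambda>x. (- weak_div q \<Omega> y x + f x) * v x)"
    using Lp_mult_integrable[OF g v] assms by simp
  have w0: "0 \<le> w x" for x by (simp add: w_def)
  have \<gamma>L: "\<gamma>\<^sub>0 \<in> Linf \<Omega>" using assms by (simp add: Linf_pos_def)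
  then have \<gamma>m [measurable]: "\<gamma>\<^sub>0 \<in> borel_measurable ?M" by (simp add: Linf_def)
  obtain B where B: "AE x in ?M. \<bar>\<gamma>\<^sub>0 x\<bar> \<le> B" using Linf_AE_bounded[OF \<gamma>L] .
  obtain m where m: "\<epsilon> < m" and \<gamma>: "AE x in ?M. m \<le> \<gamma>\<^sub>0 x" using less_ess_infD[OF assms(10)] .

  \<comment> \<open>Since \<open>\<gamma>\<^sub>0 + \<delta> \<ge> m - \<epsilon> > 0\<close> almost
    everywhere, negative powers are essentially bounded. The exponents needed are
    \<open>q - 1\<close>, \<open>q\<close> and \<open>q + 1\<close>.\<close>
  have ipow: "integrable ?M (\<lambda>x. (\<gamma>\<^sub>0 x + \<delta> x) powr (- s) * w x)"
    if [measurable]: "\<delta> \<in> borel_measurable ?M" and "AE x in ?M. \<bar>\<delta> x\<bar> \<le> \<epsilon>" and "0 \<le> s" for \<delta> s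
  proof (rule integrable_mult_AE_bounded[OF iw])
    show "AE x in ?M. \<bar>(\<gamma>\<^sub>0 x + \<delta> x) powr (- s)\<bar> \<le> (m - \<epsilon>) powr (- s)"
      using that(2) \<gamma> by eventually_elim (use m \<open>0 \<le> s\<close> in \<open>auto intro!: powr_mono2'\<close>)
  qed measurable

  \<comment> \<open>A non-integrable function has integral 0 by convention, so integrability must be
    secured before a difference of errors becomes a single integral.\<close>
  have iU: "integrable ?M (U (\<lambda>x. \<gamma>\<^sub>0 x + \<delta> x))"
    if [measurable]: "\<delta> \<in> borel_measurable ?M" and \<delta>: "AE x in ?M. \<bar>\<delta> x\<bar> \<le> \<epsilon>" for \<delta>
  proof -
    have "AE x in ?M. \<bar>\<gamma>\<^sub>0 x + \<delta> x\<bar> \<le> B + \<epsilon>"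
      using B \<delta> by eventually_elim linarith
    then have 1: "integrable ?M (\<lambda>x. (\<gamma>\<^sub>0 x + \<delta> x) * A x)"
      by (intro integrable_mult_AE_bounded[OF iA]) auto
    have 2: "integrable ?M (\<lambda>x. (\<gamma>\<^sub>0 x + \<delta> x) powr (- (q - 1)) * w x)"
      using that q by (intro ipow) auto
    have "integrable ?M (\<lambda>x. (\<gamma>\<^sub>0 x + \<delta> x) * A x
        + (1 / q) * ((\<gamma>\<^sub>0 x + \<delta> x) powr (- (q - 1)) * w x) - (- weak_div q \<Omega> y x + f x) * v x)"
      using 1 2 igv by (intro Bochner_Integration.integrable_diff Bochner_Integration.integrable_add
          integrable_mult_right) auto
    \<comment> \<open>Turning the reciprocal into a negative exponent uses positivity of the
      coefficient, which is known only almost everywhere.\<close>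
    moreover have "AE x in ?M. (\<gamma>\<^sub>0 x + \<delta> x) * A x
        + (1 / q) * ((\<gamma>\<^sub>0 x + \<delta> x) powr (- (q - 1)) * w x) - (- weak_div q \<Omega> y x + f x) * v x
        = U (\<lambda>x. \<gamma>\<^sub>0 x + \<delta> x) x"
      using \<gamma> \<delta>
    proof eventually_elim
      case (elim x)
      then have "(1 / (\<gamma>\<^sub>0 x + \<delta> x)) powr (q - 1) = (\<gamma>\<^sub>0 x + \<delta> x) powr (- (q - 1))"
        using m powr_minus_divide[of "\<gamma>\<^sub>0 x + \<delta> x" "q - 1"] by (simp add: powr_divide)
      then show ?case unfolding U_def A_def w_def by (simp add: mult_ac)
    qed
    moreover have "U (\<lambda>x. \<gamma>\<^sub>0 x + \<delta> x) \<in> borel_measurable ?M"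
      using Lp_measurable[OF g] Lp_measurable[OF v] unfolding U_def by measurable
    ultimately show ?thesis
      using integrable_cong_AE_imp by blast
  qed

  have ih: "integrable ?M (h \<delta> c)" if "\<bar>c\<bar> \<le> \<epsilon>" for \<delta> c
  proof -
    \<comment> \<open>Both powers come from \<open>ipow\<close> with constant perturbations,
      \<open>0\<close> and \<open>c\<close>.\<close>
    have "integrable ?M (\<lambda>x. \<gamma>\<^sub>0 x powr (- q) * w x)"
      using ipow[of "\<lambda>_. 0" q] q assms by simp
    moreover have "integrable ?M (\<lambda>x. (\<gamma>\<^sub>0 x + c) powr (- (q + 1)) * w x)"
      using ipow[of "\<lambda>_. c" "q + 1"] q that by simp
    ultimately have "integrable ?M (\<lambda>x. \<delta> * (A x + ((1 - q) * (1 / q)) * (\<gamma>\<^sub>0 x powr (- q) * w x))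
       + \<delta>\<^sup>2 * (((1 / 2) * (q - 1)) * ((\<gamma>\<^sub>0 x + c) powr (- (q + 1)) * w x)))"
      using iA by (intro Bochner_Integration.integrable_add integrable_mult_right) auto
    then show ?thesis
      by (rule back_subst[where P = "integrable ?M"])
        (simp add: h fun_eq_iff diff_conv_add_uminus [symmetric] mult.assoc)
  qed
  have imax: "integrable ?M (\<lambda>x. max (h (- \<epsilon>) c x) (h \<epsilon> c x))" if "\<bar>c\<bar> \<le> \<epsilon>" for c
    using ih[OF that] by (intro integrable_max) auto

  let ?d = "\<lambda>\<delta> x. U (\<lambda>x. \<gamma>\<^sub>0 x + \<delta> x) x - U \<gamma>\<^sub>0 x"
  have bounds: "AE x in ?M. h (\<delta> x) \<epsilon> x \<le> ?d \<delta> x \<and> ?d \<delta> x \<le> h (\<delta> x) (- \<epsilon>) x"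
    if "AE x in ?M. \<bar>\<delta> x\<bar> \<le> \<epsilon>" for \<delta>
    using that \<gamma>
  proof eventually_elim
    case (elim x)
    \<comment> \<open>The mixed term in \<open>v\<close> and the dual residual cancels, leaving the
      \<open>r\<close> of \<open>powr_perturbation_bounds\<close>.\<close>
    have "?d \<delta> x = \<delta> x * A x + (1 / q) * (1 / (\<gamma>\<^sub>0 x + \<delta> x)) powr (q - 1) * w x
        - (1 / q) * (1 / \<gamma>\<^sub>0 x) powr (q - 1) * w x"
      by (simp add: U_def A_def w_def algebra_simps)
    then show ?case
      using powr_perturbation_bounds[of q "\<delta> x" \<epsilon> "\<gamma>\<^sub>0 x" "w x" "A x"] q elim m w0[of x]
      unfolding h by simp
  qed
  have id: "integrable ?M (?d \<delta>)"
    and Ed: "E_err \<Omega> p q f (\<lambda>x. \<gamma>\<^sub>0 x + \<delta> x) v y - E_err \<Omega> p q f \<gamma>\<^sub>0 v y = (\<integral>x. ?d \<delta> x \<partial>?M)"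
    if "\<delta> \<in> borel_measurable ?M" "AE x in ?M. \<bar>\<delta> x\<bar> \<le> \<epsilon>" for \<delta>
  proof -
    have 1: "integrable ?M (U \<gamma>\<^sub>0)" using iU[of "\<lambda>_. 0"] assms by simp
    show "integrable ?M (?d \<delta>)" using iU[OF that] 1 by simp
    \<comment> \<open>The \<open>D_G\<close> part is independent of the coefficient and drops out of
      the difference.\<close>
    have "E_err \<Omega> p q f \<gamma> v y = (\<integral>x. U \<gamma> x \<partial>?M) + D_G \<Omega> (weak_grad \<Omega> v) (\<lambda>x. - y x)" for \<gamma>
      by (simp add: E_err_def D_F_def U_def)
    then show "E_err \<Omega> p q f (\<lambda>x. \<gamma>\<^sub>0 x + \<delta> x) v y - E_err \<Omega> p q f \<gamma>\<^sub>0 v y = (\<integral>x. ?d \<delta> x \<partial>?M)"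
      using iU[OF that] 1 by simp
  qed

  have "E_ind \<Omega> p q f \<gamma>\<^sub>0 \<epsilon> v y \<le> ereal (E_ind_upper \<Omega> p q f \<gamma>\<^sub>0 \<epsilon> v y)"
    unfolding E_ind_def
  proof (rule SUP_least)
    fix \<delta> assume "\<delta> \<in> {\<delta> \<in> Linf \<Omega>. Linf_norm \<Omega> \<delta> \<le> ereal \<epsilon>}"
    then have \<delta>: "\<delta> \<in> borel_measurable ?M" "AE x in ?M. \<bar>\<delta> x\<bar> \<le> \<epsilon>"
      using Linf_norm_leD[of \<delta> \<Omega> \<epsilon>] by (auto simp: Linf_def)
    have "(\<integral>x. ?d \<delta> x \<partial>?M) \<le> (\<integral>x. max (h (- \<epsilon>) (- \<epsilon>) x) (h \<epsilon> (- \<epsilon>) x) \<partial>?M)"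
    proof (rule integral_mono_AE[OF id[OF \<delta>] imax])
      show "AE x in ?M. ?d \<delta> x \<le> max (h (- \<epsilon>) (- \<epsilon>) x) (h \<epsilon> (- \<epsilon>) x)"
        using bounds[OF \<delta>(2)] \<delta>(2)
      proof eventually_elim
        case (elim x)
        \<comment> \<open>The coefficient of the square is nonnegative because
          \<open>q > 1\<close>.\<close>
        have "h (\<delta> x) (- \<epsilon>) x \<le> max (h (- \<epsilon>) (- \<epsilon>) x) (h \<epsilon> (- \<epsilon>) x)"
          unfolding h using elim q w0[of x] by (intro quadratic_le_max_endpoints) auto
        with elim show ?case by linarith
      qed
    qed (use assms in auto)
    then show "ereal (E_err \<Omega> p q f (\<lambda>x. \<gamma>\<^sub>0 x + \<delta> x) v y - E_err \<Omega> p q f \<gamma>\<^sub>0 v y)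
        \<le> ereal (E_ind_upper \<Omega> p q f \<gamma>\<^sub>0 \<epsilon> v y)"
      using Ed[OF \<delta>] by (simp add: E_ind_upper_def h_def)
  qed
  moreover have "ereal (E_ind_lower \<Omega> p q f \<gamma>\<^sub>0 \<epsilon> v y) \<le> E_ind \<Omega> p q f \<gamma>\<^sub>0 \<epsilon> v y"
  proof -
    \<comment> \<open>The sign is chosen by comparing the minorants \<open>h\<close>, not the true
      changes \<open>?d\<close>, so that \<open>h (\<delta> x) \<epsilon> x\<close> is exactly the
      integrand of \<open>E_ind_lower\<close>. Measurability of both minorants makes the choice
      admissible.\<close>
    define \<delta> where "\<delta> x = (if h (- \<epsilon>) \<epsilon> x \<le> h \<epsilon> \<epsilon> x then \<epsilon> else - \<epsilon>)" for x
    have [measurable]: "h (- \<epsilon>) \<epsilon> \<in> borel_measurable ?M" "h \<epsilon> \<epsilon> \<in> borel_measurable ?M"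
      using ih[of \<epsilon>] assms by auto
    have \<delta>: "\<delta> \<in> borel_measurable ?M" "AE x in ?M. \<bar>\<delta> x\<bar> \<le> \<epsilon>"
      unfolding \<delta>_def using assms by auto
    have "(\<integral>x. max (h (- \<epsilon>) \<epsilon> x) (h \<epsilon> \<epsilon> x) \<partial>?M) \<le> (\<integral>x. ?d \<delta> x \<partial>?M)"
    proof (rule integral_mono_AE[OF imax id[OF \<delta>]])
      show "AE x in ?M. max (h (- \<epsilon>) \<epsilon> x) (h \<epsilon> \<epsilon> x) \<le> ?d \<delta> x"
        using bounds[OF \<delta>(2)] by eventually_elim (auto simp: \<delta>_def max_def split: if_splits)
    qed (use assms in auto)
    then have "E_ind_lower \<Omega> p q f \<gamma>\<^sub>0 \<epsilon> v y
        \<le> E_err \<Omega> p q f (\<lambda>x. \<gamma>\<^sub>0 x + \<delta> x) v y - E_err \<Omega> p q f \<gamma>\<^sub>0 v y"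
      using Ed[OF \<delta>] by (simp add: E_ind_lower_def h_def)
    then show ?thesis
      unfolding E_ind_def using Linf_normI[OF \<delta>] by (intro SUP_upper2[of \<delta>]) auto
  qed
  ultimately show ?thesis by simp
qed

end
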